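(* Let $q\ge 32$ be a prime power with $q\not\equiv 3\pmod 4$, let $\xi$ be a primitive element of $F_q$, and let $\gamma=-1$ if $q$ is odd and $\gamma=1$ if $q$ is even. Let $G$ be an integer with $\lfloor (q-1)/3\rfloor\le G\le\lceil (q-3)/2\rceil$, let $\mathcal{D}_G=\{(1,\xi^d,\xi^{2d}): d=0,1,\dots,G\}$, $Z=(1,0,\gamma)$, $B_G=(1,0,\gamma\xi^{2G})$. Then $\mathcal{W}_G=\mathcal{D}_G\cup\{Z,B_G\}$ is a $(G+3)$-arc in $PG(2,q)$.
   Context: Points of $PG(2,q)$ are in homogeneous coordinates $(x_0,x_1,x_2)$. An arc is a set of points no three collinear. *)

theory Defs
  imports "HOL-Analysis.Analysis" "HOL-Number_Theory.Prime_Powers"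
begin

text \<open>
  \<open>PG(2,q)\<close> over the field \<open>'a\<close> of order \<open>q\<close>: points and lines are the subspaces of
  \<open>'a ^ 3\<close> of dimension 1 and 2, and incidence is inclusion.
\<close>

definition pg_points :: "('a::field ^ 3) set set" where
  "pg_points = {P. vec.subspace P \<and> vec.dim P = 1}"

definition pg_lines :: "('a::field ^ 3) set set" where
  "pg_lines = {L. vec.subspace L \<and> vec.dim L = 2}"

definition pg_collinear :: "('a::field ^ 3) set set \<Rightarrow> bool" where
  "pg_collinear S \<longleftrightarrow> (\<exists>L\<in>pg_lines. \<forall>P\<in>S. P \<subseteq> L)"

definition pg_arc :: "('a::field ^ 3) set set \<Rightarrow> bool" where
  "pg_arc S \<longleftrightarrow> S \<subseteq> pg_points \<and>
     (\<forall>P\<in>S. \<forall>Q\<in>S. \<forall>R\<in>S. P \<noteq> Q \<and> P \<noteq> R \<and> Q \<noteq> R \<longrightarrow> \<not> pg_collinear {P, Q, R})"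

definition pg_n_arc :: "nat \<Rightarrow> ('a::field ^ 3) set set \<Rightarrow> bool" where
  "pg_n_arc n S \<longleftrightarrow> pg_arc S \<and> finite S \<and> card S = n"

text \<open>The point with homogeneous coordinates \<open>(x\<^sub>0, x\<^sub>1, x\<^sub>2)\<close>, which must not all vanish.\<close>

definition pg_point :: "'a::field \<Rightarrow> 'a \<Rightarrow> 'a \<Rightarrow> ('a ^ 3) set" where
  "pg_point x0 x1 x2 = vec.span {vector [x0, x1, x2]}"

definition primitive_element :: "'a::field \<Rightarrow> bool" where
  "primitive_element \<xi> \<longleftrightarrow> range (\<lambda>k::nat. \<xi> ^ k) = UNIV - {0}"

definition arc_D :: "'a::field \<Rightarrow> nat \<Rightarrow> ('a ^ 3) set set" where
  "arc_D \<xi> G = {pg_point 1 (\<xi> ^ d) (\<xi> ^ (2 * d)) | d. d \<le> G}"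

definition point_Z :: "'a::field \<Rightarrow> ('a ^ 3) set" where
  "point_Z \<gamma> = pg_point 1 0 \<gamma>"

definition point_B :: "'a::field \<Rightarrow> 'a \<Rightarrow> nat \<Rightarrow> ('a ^ 3) set" where
  "point_B \<gamma> \<xi> G = pg_point 1 0 (\<gamma> * \<xi> ^ (2 * G))"

definition arc_W :: "'a::field \<Rightarrow> 'a \<Rightarrow> nat \<Rightarrow> ('a ^ 3) set set" where
  "arc_W \<gamma> \<xi> G = arc_D \<xi> G \<union> {point_Z \<gamma>, point_B \<gamma> \<xi> G}"

end

theory Submission
  imports Defs
begin

text \<open>
  The points of \<open>arc_D\<close> lie on the conic \<open>x\<^sub>1\<^sup>2 = x\<^sub>0 x\<^sub>2\<close>, so no three of them are collinear. The points
  of the conic with parameters \<open>t \<noteq> u\<close> are collinear with \<open>(1, 0, c)\<close> iff \<open>t u = - c\<close>. As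
  \<open>\<gamma> = - 1\<close> in the field, a collinearity with \<open>Z\<close> means \<open>\<xi> ^ (i + j) = 1\<close> and one with
  \<open>B\<^sub>G\<close> means \<open>\<xi> ^ (i + j) = \<xi> ^ (2 * G)\<close>, where \<open>0 \<le> i < j \<le> G\<close>. Both are impossible, since
  \<open>0 < i + j < 2 * G < q - 1\<close>. Finally the line joining \<open>Z\<close> and \<open>B\<^sub>G\<close> is \<open>x\<^sub>1 = 0\<close>, which misses
  the points with nonzero parameter.
\<close>

lemma (in finite_dimensional_vector_space) subspace_superset_of_dim_exists:
  assumes "dim S \<le> n" and "n \<le> dimension"
  obtains T where "subspace T" "S \<subseteq> T" "dim T = n"
proof -
  obtain B where B: "B \<subseteq> S" "independent B" "S \<subseteq> span B" "card B = dim S"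
    by (rule basis_exists)
  obtain C where C: "B \<subseteq> C" "independent C" "UNIV \<subseteq> span C"
    using maximal_independent_subset_extend[of B UNIV] B(2) by auto
  have "card C = dimension"
    using C(2,3) by (metis basis_card_eq_dim dim_UNIV dimension_def subset_UNIV)
  then obtain D where D: "B \<subseteq> D" "D \<subseteq> C" "card D = n"
    using exists_subset_between[of B n C] assms B(4) C(1) finiteI_independent[OF C(2)] by auto
  show thesis
  proof
    show "S \<subseteq> span D"
      using B(3) span_mono[OF D(1)] by blast
    show "dim (span D) = n"
      using independent_mono[OF C(2) D(2)] D(3) by (simp add: dim_eq_card_independent)
  qed simp
qed

lemma det_eq_0_iff_rows_subset_hyperplane:
  fixes A :: "'a::field ^ 'n ^ 'n"
  shows "det A = 0 \<longleftrightarrow> (\<exists>L. vec.subspace L \<and> vec.dim L = CARD('n) - 1 \<and> rows A \<subseteq> L)"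
proof -
  have span_iff_dim: "vec.span (rows A) = UNIV \<longleftrightarrow> vec.dim (rows A) = CARD('n)"
    using vec.dim_eq_full[of "rows A"] by (simp add: vec.dimension_def card_cart_basis)
  have dim_le: "vec.dim (rows A) \<le> CARD('n)"
    using vec.dim_subset_UNIV[of "rows A"] by (simp add: vec.dimension_def card_cart_basis)
  have "det A = 0 \<longleftrightarrow> vec.span (rows A) \<noteq> UNIV"
    by (metis invertible_det_nz invertible_left_inverse matrix_left_invertible_span_rows_gen)
  also have "\<dots> \<longleftrightarrow> vec.dim (rows A) \<le> CARD('n) - 1"
    unfolding span_iff_dim using dim_le zero_less_card_finite[where 'a = 'n] by linarith
  also have "\<dots> \<longleftrightarrow> (\<exists>L. vec.subspace L \<and> vec.dim L = CARD('n) - 1 \<and> rows A \<subseteq> L)"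
    using vec.subspace_superset_of_dim_exists[of "rows A" "CARD('n) - 1"] vec.dim_subset
    by (metis card_cart_basis diff_le_self vec.dimension_def)
  finally show ?thesis .
qed

lemma pg_point_subset_iff:
  assumes "vec.subspace L"
  shows "pg_point x y z \<subseteq> L \<longleftrightarrow> vector [x, y, z] \<in> L"
  using assms unfolding pg_point_def
  by (meson empty_subsetI insert_subset vec.span_base insertI1 subsetD vec.span_minimal)

lemma pg_point_in_pg_points_iff: "pg_point x y z \<in> pg_points \<longleftrightarrow> x \<noteq> 0 \<or> y \<noteq> 0 \<or> z \<noteq> 0"
proof -
  have "vector [x, y, z] = (0 :: 'a ^ 3) \<longleftrightarrow> x = 0 \<and> y = 0 \<and> z = 0"
    by (simp add: vec_eq_iff forall_3)
  then show ?thesis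
    by (simp add: pg_points_def pg_point_def vec.dim_singleton)
qed

lemma pg_point_1_eq_iff: "pg_point 1 a b = pg_point 1 c d \<longleftrightarrow> a = c \<and> b = d"
proof
  assume "pg_point 1 a b = pg_point 1 c d"
  then have "vector [1, a, b] \<in> vec.span {vector [1, c, d] :: 'a ^ 3}"
    unfolding pg_point_def by (metis insertI1 vec.span_base)
  then obtain k where "vector [1, a, b] = k *s (vector [1, c, d] :: 'a ^ 3)"
    by (auto simp: vec.span_singleton)
  then show "a = c \<and> b = d"
    by (simp add: vec_eq_iff forall_3)
qed simp

lemma pg_collinear_iff_det_eq_0:
  "pg_collinear {pg_point a1 a2 a3, pg_point b1 b2 b3, pg_point c1 c2 c3} \<longleftrightarrow>
     det (vector [vector [a1, a2, a3], vector [b1, b2, b3], vector [c1, c2, c3]]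
       :: 'a::field ^ 3 ^ 3) = 0"
    (is "_ \<longleftrightarrow> det ?A = 0")
proof -
  have "rows ?A = range (\<lambda>i. ?A $ i)"
    by (auto simp: rows_def row_def vec_lambda_eta)
  then have "rows ?A = {vector [a1, a2, a3], vector [b1, b2, b3], vector [c1, c2, c3]}"
    by (simp add: UNIV_3)
  then show ?thesis
    by (auto simp: det_eq_0_iff_rows_subset_hyperplane pg_collinear_def pg_lines_def
        pg_point_subset_iff)
qed

lemma pg_n_arc_insert:
  assumes "pg_n_arc n S" and "P \<in> pg_points" and "P \<notin> S"
    and not_collinear: "\<And>Q R. \<lbrakk>Q \<in> S; R \<in> S; Q \<noteq> R\<rbrakk> \<Longrightarrow> \<not> pg_collinear {P, Q, R}"
  shows "pg_n_arc (Suc n) (insert P S)"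
proof -
  have "\<not> pg_collinear {X, Y, W}"
    if members: "X \<in> insert P S" "Y \<in> insert P S" "W \<in> insert P S"
      and distinct: "X \<noteq> Y" "X \<noteq> W" "Y \<noteq> W"
    for X Y W
  proof -
    consider "X = P" "Y \<in> S" "W \<in> S" | "Y = P" "X \<in> S" "W \<in> S" | "W = P" "X \<in> S" "Y \<in> S"
      | "X \<in> S" "Y \<in> S" "W \<in> S"
      using members distinct by blast
    then show ?thesis
    proof cases
      case 1
      then show ?thesis
        using not_collinear[of Y W] distinct by simp
    next
      case 2
      then show ?thesis
        using not_collinear[of X W] distinct by (simp add: insert_commute)
    next
      case 3
      then show ?thesis
        using not_collinear[of X Y] distinct by (simp add: insert_commute)
    next
      case 4
      then show ?thesis
        using assms(1) distinct by (simp add: pg_n_arc_def pg_arc_def)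
    qed
  qed
  with assms(1-3) show ?thesis
    by (simp add: pg_n_arc_def pg_arc_def)
qed

definition conic_point :: "'a::field \<Rightarrow> ('a ^ 3) set" where
  "conic_point t = pg_point 1 t (t\<^sup>2)"

definition axis_point :: "'a::field \<Rightarrow> ('a ^ 3) set" where
  "axis_point c = pg_point 1 0 c"

lemma conic_point_in_pg_points: "conic_point t \<in> pg_points"
  by (simp add: conic_point_def pg_point_in_pg_points_iff)

lemma axis_point_in_pg_points: "axis_point c \<in> pg_points"
  by (simp add: axis_point_def pg_point_in_pg_points_iff)

lemma inj_conic_point: "inj conic_point"
  by (simp add: inj_def conic_point_def pg_point_1_eq_iff)

lemma axis_point_eq_iff: "axis_point c = axis_point d \<longleftrightarrow> c = d"
  by (simp add: axis_point_def pg_point_1_eq_iff)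

lemma axis_point_eq_conic_point_iff: "axis_point c = conic_point t \<longleftrightarrow> c = 0 \<and> t = 0"
  by (auto simp: axis_point_def conic_point_def pg_point_1_eq_iff)

lemma pg_collinear_conic_points_iff:
  "pg_collinear {conic_point t, conic_point u, conic_point v} \<longleftrightarrow> t = u \<or> t = v \<or> u = v"
proof -
  have "pg_collinear {conic_point t, conic_point u, conic_point v} \<longleftrightarrow>
      (u - t) * (v - t) * (v - u) = 0"
    by (simp add: conic_point_def pg_collinear_iff_det_eq_0 det_3 power2_eq_square algebra_simps)
  then show ?thesis
    by auto
qed

lemma pg_collinear_axis_conic_conic_iff:
  "pg_collinear {axis_point c, conic_point t, conic_point u} \<longleftrightarrow> t = u \<or> t * u = - c"
proof -
  have "pg_collinear {axis_point c, conic_point t, conic_point u} \<longleftrightarrow> (u - t) * (t * u + c) = 0"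
    by (simp add: axis_point_def conic_point_def pg_collinear_iff_det_eq_0 det_3 power2_eq_square
        algebra_simps)
  then show ?thesis
    by (auto simp: eq_neg_iff_add_eq_0)
qed

lemma pg_collinear_axis_axis_conic_iff:
  "pg_collinear {axis_point c, axis_point d, conic_point t} \<longleftrightarrow> c = d \<or> t = 0"
proof -
  have "pg_collinear {axis_point c, axis_point d, conic_point t} \<longleftrightarrow> (c - d) * t = 0"
    by (simp add: axis_point_def conic_point_def pg_collinear_iff_det_eq_0 det_3 algebra_simps)
  then show ?thesis
    by auto
qed

lemma pg_n_arc_conic_points:
  assumes "finite T"
  shows "pg_n_arc (card T) (conic_point ` T)"
proof -
  have "pg_arc (conic_point ` T)"
    by (auto simp: pg_arc_def conic_point_in_pg_points pg_collinear_conic_points_iff)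
  then show ?thesis
    using assms by (simp add: pg_n_arc_def card_image inj_on_subset[OF inj_conic_point])
qed

lemma pg_n_arc_conic_points_insert_two_axis_points:
  assumes "finite T" and "0 \<notin> T" and "c \<noteq> d"
    and mult_neq: "\<And>t u. \<lbrakk>t \<in> T; u \<in> T; t \<noteq> u\<rbrakk> \<Longrightarrow> t * u \<noteq> - c \<and> t * u \<noteq> - d"
  shows "pg_n_arc (card T + 2) (conic_point ` T \<union> {axis_point c, axis_point d})"
proof -
  have axis_notin: "axis_point e \<notin> conic_point ` T" for e
    using assms(2) by (auto simp: axis_point_eq_conic_point_iff)
  have not_collinear_conic: "\<not> pg_collinear {axis_point e, Q, R}"
    if "e \<in> {c, d}" "Q \<in> conic_point ` T" "R \<in> conic_point ` T" "Q \<noteq> R" for e Q R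
  proof -
    obtain t u where "Q = conic_point t" "R = conic_point u" "t \<in> T" "u \<in> T" "t \<noteq> u"
      using \<open>Q \<in> _\<close> \<open>R \<in> _\<close> \<open>Q \<noteq> R\<close> by blast
    then show ?thesis
      using mult_neq[of t u] \<open>e \<in> _\<close> by (auto simp: pg_collinear_axis_conic_conic_iff)
  qed
  have not_collinear_axis: "\<not> pg_collinear {axis_point c, axis_point d, Q}"
      "\<not> pg_collinear {axis_point c, Q, axis_point d}" if "Q \<in> conic_point ` T" for Q
    using that assms(2,3)
    by (auto simp: pg_collinear_axis_axis_conic_iff insert_commute[of _ "axis_point d"])
  have "pg_n_arc (Suc (card T)) (insert (axis_point d) (conic_point ` T))"
    using not_collinear_conic
    by (intro pg_n_arc_insert pg_n_arc_conic_points assms(1) axis_notin axis_point_in_pg_points) simp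
  then have "pg_n_arc (Suc (Suc (card T)))
      (insert (axis_point c) (insert (axis_point d) (conic_point ` T)))"
  proof (rule pg_n_arc_insert)
    show "axis_point c \<notin> insert (axis_point d) (conic_point ` T)"
      using assms(3) axis_notin by (simp add: axis_point_eq_iff)
    show "\<not> pg_collinear {axis_point c, Q, R}"
      if "Q \<in> insert (axis_point d) (conic_point ` T)" "R \<in> insert (axis_point d) (conic_point ` T)"
        "Q \<noteq> R" for Q R
      using that by (elim insertE) (simp_all add: not_collinear_conic not_collinear_axis)
  qed (rule axis_point_in_pg_points)
  then show ?thesis
    by simp
qed

lemma arc_W_eq:
  "arc_W \<gamma> \<xi> G =
     conic_point ` (\<lambda>d. \<xi> ^ d) ` {..G} \<union> {axis_point \<gamma>, axis_point (\<gamma> * \<xi> ^ (2 * G))}"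
proof -
  have "arc_D \<xi> G = conic_point ` (\<lambda>d. \<xi> ^ d) ` {..G}"
    by (auto simp: arc_D_def conic_point_def image_image mult.commute[of 2] power_mult)
  then show ?thesis
    by (simp add: arc_W_def point_Z_def point_B_def axis_point_def)
qed

lemma pg_n_arc_arc_W_minus_1:
  fixes \<xi> :: "'a::field"
  assumes "G > 0" and inj: "inj_on (\<lambda>k. \<xi> ^ k) {..2 * G}"
  shows "pg_n_arc (G + 3) (arc_W (- 1) \<xi> G)"
proof -
  let ?T = "(\<lambda>d. \<xi> ^ d) ` {..G}"
  have power_eq_iff: "\<xi> ^ i = \<xi> ^ j \<longleftrightarrow> i = j" if "i \<le> 2 * G" "j \<le> 2 * G" for i j
    using inj_on_eq_iff[OF inj] that by simp
  have "\<xi> \<noteq> 0"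
    using power_eq_iff[of 1 2] assms(1) by auto
  have "t * u \<noteq> 1 \<and> t * u \<noteq> \<xi> ^ (2 * G)"
    if "t \<in> ?T" "u \<in> ?T" "t \<noteq> u" for t u
  proof -
    obtain i j where powers: "t = \<xi> ^ i" "u = \<xi> ^ j" and ij: "i \<le> G" "j \<le> G"
      using \<open>t \<in> ?T\<close> \<open>u \<in> ?T\<close> by blast
    then have "i \<noteq> j"
      using \<open>t \<noteq> u\<close> by blast
    then have "0 < i + j" "i + j < 2 * G"
      using ij by arith+
    then have "\<xi> ^ (i + j) \<noteq> 1" "\<xi> ^ (i + j) \<noteq> \<xi> ^ (2 * G)"
      using power_eq_iff[of "i + j" 0] power_eq_iff[of "i + j" "2 * G"] by simp_all
    then show ?thesis
      by (simp add: powers power_add)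
  qed
  moreover have "\<xi> ^ (2 * G) \<noteq> 1"
    using power_eq_iff[of "2 * G" 0] assms(1) by simp
  ultimately have "pg_n_arc (card ?T + 2) (arc_W (- 1) \<xi> G)"
    unfolding arc_W_eq using \<open>\<xi> \<noteq> 0\<close>
    by (intro pg_n_arc_conic_points_insert_two_axis_points) auto
  moreover have "card ?T = G + 1"
    using inj_on_subset[OF inj, of "{..G}"] by (simp add: card_image)
  ultimately show ?thesis
    by (simp add: numeral_3_eq_3)
qed

(* The library's finite_field_power_card_eq_same does not apply: the class finite_field is a proper
   subsort of {field, finite}. *)
lemma power_CARD_minus_1_eq_1:
  fixes a :: "'a::{field,finite}"
  assumes "a \<noteq> 0"
  shows "a ^ (CARD('a) - 1) = 1"
proof -
  let ?U = "UNIV - {0 :: 'a}"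
  have "(\<Prod>x\<in>?U. x) = (\<Prod>x\<in>?U. a * x)"
    by (rule prod.reindex_bij_witness[of _ "\<lambda>x. a * x" "\<lambda>x. x / a"]) (use assms in auto)
  also have "\<dots> = a ^ card ?U * (\<Prod>x\<in>?U. x)"
    by (simp add: prod.distrib)
  finally show ?thesis
    by (simp add: card_Diff_singleton)
qed

lemma minus_1_eq_1_if_even_CARD:
  assumes "even CARD('a::{field,finite})"
  shows "(- 1 :: 'a) = 1"
proof -
  have "odd (CARD('a) - 1)"
    using assms by simp
  then show ?thesis
    using power_CARD_minus_1_eq_1[of "- 1 :: 'a"] by simp
qed

lemma primitive_element_imp_inj_on_power:
  fixes \<xi> :: "'a::{field,finite}"
  assumes "primitive_element \<xi>"
  shows "inj_on (\<lambda>k. \<xi> ^ k) {..<CARD('a) - 1}"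
proof (rule eq_card_imp_inj_on)
  let ?n = "CARD('a) - 1"
  have range: "range (\<lambda>k::nat. \<xi> ^ k) = UNIV - {0}"
    using assms by (simp add: primitive_element_def)
  then have "\<xi> \<noteq> 0"
    using rangeI[of "\<lambda>k. \<xi> ^ k" 1] by simp
  have power_mod: "\<xi> ^ k = \<xi> ^ (k mod ?n)" for k
  proof -
    have "\<xi> ^ k = (\<xi> ^ ?n) ^ (k div ?n) * \<xi> ^ (k mod ?n)"
      by (simp flip: power_mult power_add)
    then show ?thesis
      using power_CARD_minus_1_eq_1[OF \<open>\<xi> \<noteq> 0\<close>] by simp
  qed
  have "?n > 0"
    using card_mono[of UNIV "{0, 1 :: 'a}"] by simp
  then have "\<xi> ^ k \<in> (\<lambda>k. \<xi> ^ k) ` {..<?n}" for k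
    using power_mod[of k] by (intro image_eqI[of _ _ "k mod ?n"]) auto
  then have "(\<lambda>k. \<xi> ^ k) ` {..<?n} = UNIV - {0}"
    unfolding range[symmetric] by blast
  then show "card ((\<lambda>k. \<xi> ^ k) ` {..<?n}) = card {..<?n}"
    by (simp add: card_Diff_singleton)
qed simp

theorem theorem14:
  fixes q G :: nat and \<xi> \<gamma> :: "'a::{field,finite}"
  assumes "primepow q" and "CARD('a) = q"
    and "q \<ge> 32" and "q mod 4 \<noteq> 3"
    and "primitive_element \<xi>"
    and "\<gamma> = (if odd q then - 1 else 1)"
    and "\<lfloor>(real q - 1) / 3\<rfloor> \<le> int G" and "int G \<le> \<lceil>(real q - 3) / 2\<rceil>"
  shows "pg_n_arc (G + 3) (arc_W \<gamma> \<xi> G)"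
proof -
  have "\<gamma> = - 1"
    using assms(2,6) minus_1_eq_1_if_even_CARD[where 'a = 'a] by simp
  have "1 \<le> \<lfloor>(real q - 1) / 3\<rfloor>"
    using assms(3) by (simp add: le_floor_iff)
  then have "G > 0"
    using assms(7) by linarith
  have "real (2 * G + 1) < real q"
    using assms(8) by (simp add: le_ceiling_iff field_simps)
  then have "{..2 * G} \<subseteq> {..<CARD('a) - 1}"
    using assms(2) by (auto simp only: of_nat_less_iff)
  then have "inj_on (\<lambda>k. \<xi> ^ k) {..2 * G}"
    by (rule inj_on_subset[OF primitive_element_imp_inj_on_power[OF assms(5)]])
  with \<open>G > 0\<close> show ?thesis
    unfolding \<open>\<gamma> = - 1\<close> by (rule pg_n_arc_arc_W_minus_1)
qed

end
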